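(* Let $s\in\mathcal S(n+1)$ for some $n\in\omega$ and let $M_0,\dots,M_{\ell(s)-1}$ be uniform chains of rank $\omega$ such that (a) $\mathrm f M_i\cong\mathrm f M_j$ for all $i,j<\ell(s)$, and (b) $M_i\cong M_j$ whenever $i,j<\ell(s)$ and $\mathrm{wt}^s(i)=\mathrm{wt}^s(j)$. Then the chain $A=\mathcal A(s)[M_0,\dots,M_{\ell(s)-1}]$ is uniform, and its tail satisfies $$\mathrm f\bigl(\mathcal A(s)[M_0,\dots,M_{\ell(s)-1}]\bigr)\cong\mathcal A(\mathrm f s)\bigl[\mathrm f_s(M_0,\dots,M_{\ell(s)-1})\bigr].$$
   Context: A chain is a linearly ordered set; $\cong$ is order isomorphism. $A+B$ and $\sum_{i\in I}A_i$ are ordered sums, $AB=\sum_{b\in B}A$ is the anti-lexicographically ordered product; $\mathbb N,\mathbb Z$ have their usual orders and $1$ is the one-element chain. For a chain $A$ define convex equivalence relations $\rho_\alpha$ ($\alpha$ an ordinal): $\rho_0$ is equality; $A/\alpha$ is the quotient chain of $\rho_\alpha$-classes and $[x]_\alpha$ is the class of $x$; $x\rho_{\alpha+1}y$ iff the interval between $[x]_\alpha$ and $[y]_\alpha$ in $A/\alpha$ is finite; for limit $\alpha$, $x\rho_\alpha y$ iff $x\rho_\beta y$ for some $\beta<\alpha$. The rank $\mathrm{rk}(A)$ is the least $\alpha$ with $A/\alpha\cong 1$. All chains are assumed decomposable (their rank is defined). $A$ is uniform if $A^{\ge x}=\{y\in A:x\le y\}$ has the same order type for all $x\in A$; then $\mathrm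 f A$ denotes this common tail. $\mathcal S(m)$ is the set of sequences $s=(s(0),\dots,s(m-1))$ of natural numbers with $s(i)\le i$ for all $i<m$; $|s|=m$. For $s$ of length $n+1\ge2$: $s^-$ is $s$ with its last entry deleted, and $s^+$ is $s$ with its next-to-last entry $s(n-1)$ deleted; $s^+\in\mathcal S(n)$ iff $s(n)<n$. $\mathrm f s$ is the sequence obtained from $s$ by replacing its last entry with $0$. The tree of $s$ (nonempty) has root $(s;0)$; a node $(t;k)$ with $|t|=m+1\ge 2$ has the single child $(t^-;0)$ if $t(m)=m$, and a left child $(t^+;k+1)$ and a right child $(t^-;0)$ if $t(m)<m$. The leaves are the nodes $(\langle 0\rangle;k)$ on level $|s|-1$, ordered from left to right; $\ell(s)$ is their number and $\mathrm{wt}^s(i)=k$ if the $i$th leaf ($0\le i<\ell(s)$) is $(\langle0\rangle;k)$. For uniform chains $M_i$ of rank $\omega$: $\mathcal A(\langle0\rangle)[M_0]=M_0$, and for $s$ of length $n+1\ge 2$, $\mathcal A(s)[M_0,\dots,M_{\ell(s)-1}]=\mathcal A(s^-)[M_0,\dots,M_{\ell(s^-)-1}]\,\mathbb Z$ if $s(n)=n$ (then $\ell(s)=\ell(s^-)$), and $=\mathcal A(s^+)[M_0,\dots,M_{\ell(s^+)-1}]+\mathcal A(s^-)[M_{\ell(s^+)},\dots,M_{\ell(s)-1}]\,\mathbb N$ if $s(n)<n$ (then $\ell(s)=\ell(s^+)+\ell(s^-)$). Tail arrays: $\mathrm f_{\langle0\rangle}(M_0)=(\mathrm f M_0)$; for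 $s$ of length $n+1\ge2$, $\mathrm f_s(M_0,\dots,M_{\ell(s)-1})$ is the concatenation of $\mathrm f_{s^+}(M_0,\dots,M_{\ell(s^+)-1})$ with $(M_{\ell(s^+)},\dots,M_{\ell(s)-1})$ if $s(n)<n$, and the concatenation of $\mathrm f_{s^-}(M_0,\dots,M_{\ell(s)-1})$ with $(M_0,\dots,M_{\ell(s)-1})$ if $s(n)=n$. *)

theory Defs
  imports Main "HOL-Library.Extended_Nat"
begin

section \<open>Chains\<close>

text \<open>
  A chain is a reflexive linear order \<open>r\<close> with \<open>Linear_order r\<close>; its underlying set is
  \<open>Field r\<close>. The library constant \<^const>\<open>iso\<close> lives in the theory of well-orders but is
  meaningful for arbitrary relations; see \<open>chain_iso_iff\<close> below.
\<close>

definition chain_iso :: "'a rel \<Rightarrow> 'b rel \<Rightarrow> bool" (infix "\<cong>\<^sub>c" 50) where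
  "r \<cong>\<^sub>c r' \<longleftrightarrow> (\<exists>f. iso r r' f)"

lemma chain_iso_iff:
  "r \<cong>\<^sub>c r' \<longleftrightarrow>
    (\<exists>f. bij_betw f (Field r) (Field r') \<and>
         (\<forall>x\<in>Field r. \<forall>y\<in>Field r. (x, y) \<in> r \<longleftrightarrow> (f x, f y) \<in> r'))"
proof -
  have "iso r r' f \<longleftrightarrow> bij_betw f (Field r) (Field r') \<and>
         (\<forall>x\<in>Field r. \<forall>y\<in>Field r. (x, y) \<in> r \<longleftrightarrow> (f x, f y) \<in> r')" (is "?L \<longleftrightarrow> ?R") for f
  proof
    assume L: ?L
    then have bij: "bij_betw f (Field r) (Field r')" and
      un: "\<And>y. y \<in> Field r \<Longrightarrow> bij_betw f (under r y) (under r' (f y))"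
      by (auto simp: iso_def embed_def)
    have "(x, y) \<in> r \<longleftrightarrow> (f x, f y) \<in> r'" if x: "x \<in> Field r" and y: "y \<in> Field r" for x y
    proof -
      have "f ` under r y = under r' (f y)" using un[OF y] by (simp add: bij_betw_def)
      moreover have "under r y \<subseteq> Field r" by (auto simp: under_def Field_def)
      moreover have "inj_on f (Field r)" using bij by (simp add: bij_betw_def)
      ultimately have "x \<in> under r y \<longleftrightarrow> f x \<in> under r' (f y)"
        using x by (metis inj_on_image_mem_iff)
      then show ?thesis by (simp add: under_def)
    qed
    with bij show ?R by blast
  next
    assume R: ?R
    then have bij: "bij_betw f (Field r) (Field r')" by blast
    have "bij_betw f (under r y) (under r' (f y))" if y: "y \<in> Field r" for y
    proof -
      have sub: "under r y \<subseteq> Field r" and sub': "under r' (f y) \<subseteq> Field r'"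
        by (auto simp: under_def Field_def)
      have "f ` under r y = under r' (f y)"
      proof
        show "f ` under r y \<subseteq> under r' (f y)"
          using R y sub by (auto simp: under_def dest: subsetD)
        show "under r' (f y) \<subseteq> f ` under r y"
        proof
          fix z assume z: "z \<in> under r' (f y)"
          then obtain x where "x \<in> Field r" "z = f x"
            using sub' bij by (auto simp: bij_betw_def)
          with z R y show "z \<in> f ` under r y" by (auto simp: under_def)
        qed
      qed
      then show ?thesis
        using bij sub by (auto simp: bij_betw_def intro: inj_on_subset)
    qed
    with bij show ?L by (simp add: iso_def embed_def)
  qed
  then show ?thesis by (simp add: chain_iso_def)
qed

definition one_chain :: "unit rel" where
  "one_chain = {((), ())}"

definition nat_chain :: "nat rel" where
  "nat_chain = {(i, j). i \<le> j}"

definition int_chain :: "int rel" where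
  "int_chain = {(i, j). i \<le> j}"

definition chain_sum :: "'a rel \<Rightarrow> 'b rel \<Rightarrow> ('a + 'b) rel" where
  "chain_sum r r' =
     {(Inl a, Inl b) | a b. (a, b) \<in> r} \<union>
     {(Inl a, Inr b) | a b. a \<in> Field r \<and> b \<in> Field r'} \<union>
     {(Inr a, Inr b) | a b. (a, b) \<in> r'}"

definition chain_prod :: "'a rel \<Rightarrow> 'b rel \<Rightarrow> ('a \<times> 'b) rel" where
  "chain_prod r r' =
     {((a, b), (a', b')). a \<in> Field r \<and> a' \<in> Field r \<and> (b, b') \<in> r' \<and>
                          (b = b' \<longrightarrow> (a, a') \<in> r)}"

definition final_seg :: "'a rel \<Rightarrow> 'a \<Rightarrow> 'a rel" where
  "final_seg r x = Restr r (above r x)"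

definition uniform_chain :: "'a rel \<Rightarrow> bool" where
  "uniform_chain r \<longleftrightarrow> Linear_order r \<and>
     (\<forall>x\<in>Field r. \<forall>y\<in>Field r. final_seg r x \<cong>\<^sub>c final_seg r y)"

text \<open>
  The common tail of a uniform chain is an order type; it is represented by the final segment
  at an arbitrary point. The value is meaningful for nonempty uniform chains only.
\<close>

definition tail :: "'a rel \<Rightarrow> 'a rel" where
  "tail r = final_seg r (SOME x. x \<in> Field r)"


section \<open>Condensations and rank\<close>

text \<open>The chain of \<open>E\<close>-classes of \<open>r\<close>, for a convex equivalence relation \<open>E\<close> on \<open>Field r\<close>.\<close>

definition quot_chain :: "'a rel \<Rightarrow> 'a rel \<Rightarrow> 'a set rel" where
  "quot_chain r E = {(E `` {x}, E `` {y}) | x y. (x, y) \<in> r}"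

definition interval :: "'a rel \<Rightarrow> 'a \<Rightarrow> 'a \<Rightarrow> 'a set" where
  "interval r x y = {z. (x, z) \<in> r \<and> (z, y) \<in> r \<or> (y, z) \<in> r \<and> (z, x) \<in> r}"

text \<open>
  An element \<open>\<alpha>\<close> of a well-ordered type stands for the ordinal that is the order type of
  \<open>{..<\<alpha>}\<close>. The least element is the ordinal \<open>0\<close>, and \<open>\<alpha>\<close> is the successor of \<open>\<beta>\<close> iff
  \<open>\<beta> < \<alpha>\<close> and \<open>{..<\<alpha>} = {..\<beta>}\<close>.
\<close>

function rho :: "'a rel \<Rightarrow> 'o::wellorder \<Rightarrow> 'a rel" where
  "rho r \<alpha> =
     {(x, y). x \<in> Field r \<and> y \<in> Field r \<and>
       (if {..<\<alpha>} = {} then x = y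
        else if \<exists>\<beta>\<in>{..<\<alpha>}. {..<\<alpha>} = {..\<beta>} then
          (\<exists>\<beta>\<in>{..<\<alpha>}. {..<\<alpha>} = {..\<beta>} \<and>
             finite (interval (quot_chain r (rho r \<beta>)) (rho r \<beta> `` {x}) (rho r \<beta> `` {y})))
        else (\<exists>\<beta>\<in>{..<\<alpha>}. (x, y) \<in> rho r \<beta>))}"
  by pat_completeness auto
termination
  by (relation "inv_image {(\<alpha>, \<beta>). \<alpha> < \<beta>} snd") (auto intro: wf_inv_image wf)

declare rho.simps [simp del]

definition has_rank :: "'a rel \<Rightarrow> 'o::wellorder \<Rightarrow> bool" where
  "has_rank r \<alpha> \<longleftrightarrow> quot_chain r (rho r \<alpha>) \<cong>\<^sub>c one_chain \<and>
     (\<forall>\<beta><\<alpha>. \<not> quot_chain r (rho r \<beta>) \<cong>\<^sub>c one_chain)"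

text \<open>
  In the well-order \<^typ>\<open>enat\<close> the element \<open>\<infinity>\<close> stands for the ordinal \<open>\<omega>\<close>, its predecessors
  being exactly the natural numbers.
\<close>

definition has_rank_omega :: "'a rel \<Rightarrow> bool" where
  "has_rank_omega r \<longleftrightarrow> has_rank r (\<infinity> :: enat)"


section \<open>Sequences and their trees\<close>

definition seqs :: "nat \<Rightarrow> nat list set" where
  "seqs m = {s. length s = m \<and> (\<forall>i<m. s ! i \<le> i)}"

definition seq_minus :: "nat list \<Rightarrow> nat list" where
  "seq_minus s = butlast s"

definition seq_plus :: "nat list \<Rightarrow> nat list" where
  "seq_plus s = butlast (butlast s) @ [last s]"

definition seq_f :: "nat list \<Rightarrow> nat list" where
  "seq_f s = butlast s @ [0]"

lemma length_seq_minus [termination_simp]: "length (seq_minus s) = length s - 1"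
  by (simp add: seq_minus_def)

lemma length_seq_plus [termination_simp]: "length (seq_plus s) = length s - 2 + 1"
  by (simp add: seq_plus_def)

text \<open>A node \<open>(t; k)\<close> together with its list of subtrees, from left to right.\<close>

datatype seq_tree = Node "nat list" nat "seq_tree list"

text \<open>\<open>node_tree t k\<close> is the tree below the node \<open>(t; k)\<close>. For \<open>t \<in> seqs (m + 1)\<close> the
  condition \<open>t ! m \<noteq> m\<close> is the same as \<open>t ! m < m\<close>.\<close>

function node_tree :: "nat list \<Rightarrow> nat \<Rightarrow> seq_tree" where
  "node_tree t k =
     Node t k
       (if length t \<le> 1 then []
        else if last t = length t - 1 then [node_tree (seq_minus t) 0]
        else [node_tree (seq_plus t) (k + 1), node_tree (seq_minus t) 0])"
  by pat_completeness auto
termination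
  by (relation "measure (\<lambda>(t, k). length t)") (auto simp: length_seq_minus length_seq_plus)

declare node_tree.simps [simp del]

fun leaves :: "seq_tree \<Rightarrow> (nat list \<times> nat) list" where
  "leaves (Node t k cs) = (if cs = [] then [(t, k)] else concat (map leaves cs))"

definition tree :: "nat list \<Rightarrow> seq_tree" where
  "tree s = node_tree s 0"

definition ell :: "nat list \<Rightarrow> nat" where
  "ell s = length (leaves (tree s))"

definition wt :: "nat list \<Rightarrow> nat \<Rightarrow> nat" where
  "wt s i = snd (leaves (tree s) ! i)"


section \<open>The chains built from a sequence, and tail arrays\<close>

text \<open>
  The points of the iterated sums and products need a single type that is independent of the
  sequence; the constructors are mere tags, applied with \<^const>\<open>dir_image\<close>.
\<close>

datatype 'a point =
    Base_pt 'a
  | Prod_pt "'a point \<times> int"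
  | Sum_pt "'a point + 'a point \<times> nat"

function seq_chain :: "nat list \<Rightarrow> 'a rel list \<Rightarrow> 'a point rel" where
  "seq_chain s M =
     (if length s \<le> 1 then dir_image (M ! 0) Base_pt
      else if last s = length s - 1 then
        dir_image (chain_prod (seq_chain (seq_minus s) M) int_chain) Prod_pt
      else
        dir_image
          (chain_sum (seq_chain (seq_plus s) (take (ell (seq_plus s)) M))
             (chain_prod (seq_chain (seq_minus s) (drop (ell (seq_plus s)) M)) nat_chain))
          Sum_pt)"
  by pat_completeness auto
termination
  by (relation "measure (\<lambda>(s, M). length s)") (auto simp: length_seq_minus length_seq_plus)

declare seq_chain.simps [simp del]

function tail_array :: "nat list \<Rightarrow> 'a rel list \<Rightarrow> 'a rel list" where
  "tail_array s M =
     (if length s \<le> 1 then [tail (M ! 0)]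
      else if last s = length s - 1 then tail_array (seq_minus s) M @ M
      else tail_array (seq_plus s) (take (ell (seq_plus s)) M) @ drop (ell (seq_plus s)) M)"
  by pat_completeness auto
termination
  by (relation "measure (\<lambda>(s, M). length s)") (auto simp: length_seq_minus length_seq_plus)

declare tail_array.simps [simp del]

end

theory Submission
  imports Defs
begin

text \<open>
  The proof is an induction on the length of \<open>s\<close>. Write a sequence of length at least two as
  \<open>s = t @ [c, a]\<close>, so that \<open>s\<^sup>- = t @ [c]\<close> and \<open>s\<^sup>+ = t @ [a]\<close>. If \<open>a\<close> has its maximal value, the
  chain is \<open>B \<int>\<close> with \<open>B\<close> the chain of \<open>s\<^sup>-\<close>, and a point of \<open>B \<int>\<close> cuts off a tail of \<open>B\<close> followed
  by \<open>B \<nat>\<close>. Otherwise the chain is \<open>A + B \<nat>\<close> with \<open>A\<close> the chain of \<open>s\<^sup>+\<close>; a point of the first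
  summand cuts off a tail of \<open>A\<close> followed by \<open>B \<nat>\<close>, a point of the second one a tail of \<open>B\<close> followed
  by \<open>B \<nat>\<close>. So one has to see that \<open>A\<close> and \<open>B\<close> have the same tail; the formula for the tail then
  drops out of the induction hypothesis and of \<open>f s = t @ [c, 0]\<close>
  (\<open>uniform_with_tail_prod_int\<close>, \<open>uniform_with_tail_sum_prod_nat\<close>).

  By the induction hypothesis both tails are chains of the same sequence
  \<open>f (s\<^sup>+) = f (s\<^sup>-) = t @ [0]\<close>, applied to the tail arrays of \<open>s\<^sup>+\<close> and of \<open>s\<^sup>-\<close>. Hence it
  suffices that these two arrays are isomorphic entry by entry, which is \<open>tail_array_last_entry\<close>:
  the tail arrays of any two sequences that differ only in their last entry agree as soon as leaves
  of equal weight carry isomorphic chains and all the chains have the same tail. Hypotheses on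
  weights pass to subtrees without any computation once the label \<open>k\<close> of the root \<open>(s; k)\<close> is
  arbitrary, and the induction is carried out in this form (\<open>uniform_with_tail_seq_chain\<close>).
\<close>

section \<open>Isomorphism of chains\<close>

lemma chain_isoI:
  assumes "bij_betw f (Field r) (Field r')"
    and "\<And>x y. x \<in> Field r \<Longrightarrow> y \<in> Field r \<Longrightarrow> (x, y) \<in> r \<longleftrightarrow> (f x, f y) \<in> r'"
  shows "r \<cong>\<^sub>c r'"
  using assms unfolding chain_iso_iff by blast

lemma chain_isoE:
  assumes "r \<cong>\<^sub>c r'"
  obtains f where "bij_betw f (Field r) (Field r')"
    and "\<And>x y. x \<in> Field r \<Longrightarrow> y \<in> Field r \<Longrightarrow> (x, y) \<in> r \<longleftrightarrow> (f x, f y) \<in> r'"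
  using assms unfolding chain_iso_iff by blast

lemma chain_iso_refl: "r \<cong>\<^sub>c r"
  by (rule chain_isoI[of id]) auto

lemma chain_iso_trans [trans]:
  assumes "r \<cong>\<^sub>c r'" and "r' \<cong>\<^sub>c r''"
  shows "r \<cong>\<^sub>c r''"
proof -
  obtain f where f: "bij_betw f (Field r) (Field r')"
    "\<And>x y. x \<in> Field r \<Longrightarrow> y \<in> Field r \<Longrightarrow> (x, y) \<in> r \<longleftrightarrow> (f x, f y) \<in> r'"
    using assms(1) by (rule chain_isoE) blast
  obtain g where g: "bij_betw g (Field r') (Field r'')"
    "\<And>x y. x \<in> Field r' \<Longrightarrow> y \<in> Field r' \<Longrightarrow> (x, y) \<in> r' \<longleftrightarrow> (g x, g y) \<in> r''"
    using assms(2) by (rule chain_isoE) blast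
  show ?thesis
  proof (rule chain_isoI)
    show "bij_betw (g \<circ> f) (Field r) (Field r'')"
      using f(1) g(1) by (rule bij_betw_trans)
    show "(x, y) \<in> r \<longleftrightarrow> ((g \<circ> f) x, (g \<circ> f) y) \<in> r''" if "x \<in> Field r" "y \<in> Field r" for x y
      using that bij_betwE[OF f(1)] by (simp add: f(2) g(2))
  qed
qed

lemma chain_iso_sym:
  assumes "r \<cong>\<^sub>c r'"
  shows "r' \<cong>\<^sub>c r"
proof -
  obtain f where f: "bij_betw f (Field r) (Field r')"
    "\<And>x y. x \<in> Field r \<Longrightarrow> y \<in> Field r \<Longrightarrow> (x, y) \<in> r \<longleftrightarrow> (f x, f y) \<in> r'"
    using assms by (rule chain_isoE) blast
  let ?g = "the_inv_into (Field r) f"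
  show ?thesis
  proof (rule chain_isoI)
    show "bij_betw ?g (Field r') (Field r)"
      using f(1) by (rule bij_betw_the_inv_into)
    have "?g z \<in> Field r \<and> f (?g z) = z" if "z \<in> Field r'" for z
      using that f(1) \<open>bij_betw ?g (Field r') (Field r)\<close>
      by (meson bij_betwE f_the_inv_into_f_bij_betw)
    then show "(x, y) \<in> r' \<longleftrightarrow> (?g x, ?g y) \<in> r" if "x \<in> Field r'" "y \<in> Field r'" for x y
      using that f(2)[of "?g x" "?g y"] by simp
  qed
qed

lemma chain_iso_Field_empty_iff:
  assumes "r \<cong>\<^sub>c r'"
  shows "Field r = {} \<longleftrightarrow> Field r' = {}"
  using assms unfolding chain_iso_iff bij_betw_def by auto

lemma chain_iso_dir_image:
  assumes "inj f"
  shows "r \<cong>\<^sub>c dir_image r f"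
proof (rule chain_isoI)
  have "Field (dir_image r f) = f ` Field r"
    by (rule dir_image_Field)
  then show "bij_betw f (Field r) (Field (dir_image r f))"
    using assms by (auto simp: bij_betw_def intro: inj_on_subset)
  show "(x, y) \<in> r \<longleftrightarrow> (f x, f y) \<in> dir_image r f" for x y
    using assms by (auto simp: dir_image_def inj_eq)
qed

lemma Linear_order_iff:
  "Linear_order r \<longleftrightarrow> (\<forall>x\<in>Field r. (x, x) \<in> r) \<and> trans r \<and> antisym r \<and>
     (\<forall>x\<in>Field r. \<forall>y\<in>Field r. (x, y) \<in> r \<or> (y, x) \<in> r)"
proof -
  have "r \<subseteq> Field r \<times> Field r"
    by (auto simp: Field_def)
  then show ?thesis
    by (fastforce simp: order_on_defs refl_on_def total_on_def)
qed

lemma Linear_order_chain_iso: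
  assumes "Linear_order r" and "r \<cong>\<^sub>c r'"
  shows "Linear_order r'"
proof -
  obtain f where f: "bij_betw f (Field r') (Field r)"
    "\<And>x y. x \<in> Field r' \<Longrightarrow> y \<in> Field r' \<Longrightarrow> (x, y) \<in> r' \<longleftrightarrow> (f x, f y) \<in> r"
    using chain_iso_sym[OF assms(2)] by (rule chain_isoE) blast
  have F: "f x \<in> Field r" if "x \<in> Field r'" for x
    using f(1) that by (auto simp: bij_betw_def)
  have lin: "\<And>x. x \<in> Field r \<Longrightarrow> (x, x) \<in> r" "trans r" "antisym r"
      "\<And>x y. x \<in> Field r \<Longrightarrow> y \<in> Field r \<Longrightarrow> (x, y) \<in> r \<or> (y, x) \<in> r"
    using assms(1) unfolding Linear_order_iff by blast+
  have "trans r'"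
  proof (rule transI)
    fix x y z assume xyz: "(x, y) \<in> r'" "(y, z) \<in> r'"
    then have "x \<in> Field r'" "y \<in> Field r'" "z \<in> Field r'"
      by (auto simp: Field_def)
    then show "(x, z) \<in> r'"
      using xyz f(2) transD[OF lin(2), of "f x" "f y" "f z"] by simp
  qed
  moreover have "antisym r'"
  proof (rule antisymI)
    fix x y assume xy: "(x, y) \<in> r'" "(y, x) \<in> r'"
    then have "x \<in> Field r'" "y \<in> Field r'"
      by (auto simp: Field_def)
    then show "x = y"
      using xy f antisymD[OF lin(3), of "f x" "f y"] by (auto simp: bij_betw_def inj_on_def)
  qed
  ultimately show ?thesis
    unfolding Linear_order_iff using F lin(1,4) by (simp add: f(2))
qed


section \<open>Ordered sums and products\<close>

lemma chain_sum_simps [simp]: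
  "(Inl a, Inl a') \<in> chain_sum r r' \<longleftrightarrow> (a, a') \<in> r"
  "(Inl a, Inr b') \<in> chain_sum r r' \<longleftrightarrow> a \<in> Field r \<and> b' \<in> Field r'"
  "(Inr b, Inl a') \<in> chain_sum r r' \<longleftrightarrow> False"
  "(Inr b, Inr b') \<in> chain_sum r r' \<longleftrightarrow> (b, b') \<in> r'"
  by (auto simp: chain_sum_def)

lemma chain_prod_iff [simp]:
  "((a, b), (a', b')) \<in> chain_prod r r' \<longleftrightarrow>
     a \<in> Field r \<and> a' \<in> Field r \<and> (b, b') \<in> r' \<and> (b = b' \<longrightarrow> (a, a') \<in> r)"
  by (auto simp: chain_prod_def)

lemma Field_chain_sum: "Field (chain_sum r r') = Inl ` Field r \<union> Inr ` Field r'"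
proof (rule set_eqI)
  show "z \<in> Field (chain_sum r r') \<longleftrightarrow> z \<in> Inl ` Field r \<union> Inr ` Field r'" for z
    by (cases z) (auto simp: Field_def Domain_iff Range_iff split_sum_ex)
qed

text \<open>If \<open>r'\<close> has no last element, every point of the product is related to another one, so no
  reflexivity of the factors is needed.\<close>

lemma Field_chain_prod:
  assumes "\<And>b. b \<in> Field r' \<Longrightarrow> \<exists>b'. b' \<noteq> b \<and> (b, b') \<in> r'"
  shows "Field (chain_prod r r') = Field r \<times> Field r'"
proof
  show "Field (chain_prod r r') \<subseteq> Field r \<times> Field r'"
    unfolding chain_prod_def by (auto simp: Field_def)
  show "Field r \<times> Field r' \<subseteq> Field (chain_prod r r')"
  proof clarify
    fix a b assume a: "a \<in> Field r" and "b \<in> Field r'"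
    then obtain b' where "b' \<noteq> b" "(b, b') \<in> r'"
      using assms by blast
    then have "((a, b), (a, b')) \<in> chain_prod r r'"
      using a by simp
    then show "(a, b) \<in> Field (chain_prod r r')"
      by (rule FieldI1)
  qed
qed

lemma int_chain_iff [simp]: "(i, j) \<in> int_chain \<longleftrightarrow> i \<le> j"
  by (simp add: int_chain_def)

lemma nat_chain_iff [simp]: "(i, j) \<in> nat_chain \<longleftrightarrow> i \<le> j"
  by (simp add: nat_chain_def)

lemma Field_int_chain [simp]: "Field int_chain = UNIV"
  by (auto simp: int_chain_def Field_def)

lemma Field_nat_chain [simp]: "Field nat_chain = UNIV"
  by (auto simp: nat_chain_def Field_def)

lemma Linear_order_int_chain: "Linear_order int_chain"
  unfolding Linear_order_iff by (auto intro: transI antisymI)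

lemma Linear_order_nat_chain: "Linear_order nat_chain"
  unfolding Linear_order_iff by (auto intro: transI antisymI)

lemma int_chain_unbounded: "\<exists>j. j \<noteq> i \<and> (i, j) \<in> int_chain"
  by (rule exI[of _ "i + 1"]) simp

lemma nat_chain_unbounded: "\<exists>j. j \<noteq> i \<and> (i, j) \<in> nat_chain"
  by (rule exI[of _ "i + 1"]) simp

lemma Field_chain_prod_int [simp]: "Field (chain_prod r int_chain) = Field r \<times> UNIV"
  using Field_chain_prod[OF int_chain_unbounded] by simp

lemma Field_chain_prod_nat [simp]: "Field (chain_prod r nat_chain) = Field r \<times> UNIV"
  using Field_chain_prod[OF nat_chain_unbounded] by simp

lemma chain_sum_cong:
  assumes "r1 \<cong>\<^sub>c r2" and "r1' \<cong>\<^sub>c r2'"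
  shows "chain_sum r1 r1' \<cong>\<^sub>c chain_sum r2 r2'"
proof -
  obtain f where f: "bij_betw f (Field r1) (Field r2)"
    "\<And>x y. x \<in> Field r1 \<Longrightarrow> y \<in> Field r1 \<Longrightarrow> (x, y) \<in> r1 \<longleftrightarrow> (f x, f y) \<in> r2"
    using assms(1) by (rule chain_isoE) blast
  obtain g where g: "bij_betw g (Field r1') (Field r2')"
    "\<And>x y. x \<in> Field r1' \<Longrightarrow> y \<in> Field r1' \<Longrightarrow> (x, y) \<in> r1' \<longleftrightarrow> (g x, g y) \<in> r2'"
    using assms(2) by (rule chain_isoE) blast
  have maps: "f ` Field r1 = Field r2" "g ` Field r1' = Field r2'"
    "inj_on f (Field r1)" "inj_on g (Field r1')"
    using f(1) g(1) by (auto simp: bij_betw_def)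
  show ?thesis
  proof (rule chain_isoI)
    show "bij_betw (map_sum f g) (Field (chain_sum r1 r1')) (Field (chain_sum r2 r2'))"
      unfolding bij_betw_def
    proof
      show "inj_on (map_sum f g) (Field (chain_sum r1 r1'))"
        unfolding Field_chain_sum
        by (rule inj_onI) (auto dest: inj_onD[OF maps(3)] inj_onD[OF maps(4)])
      show "map_sum f g ` Field (chain_sum r1 r1') = Field (chain_sum r2 r2')"
        unfolding Field_chain_sum image_Un image_image map_sum.simps
          maps(1)[symmetric] maps(2)[symmetric] ..
    qed
    have "f x \<in> Field r2" if "x \<in> Field r1" for x
      using that maps(1) by blast
    moreover have "g x \<in> Field r2'" if "x \<in> Field r1'" for x
      using that maps(2) by blast
    ultimately show "(x, y) \<in> chain_sum r1 r1' \<longleftrightarrow>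
        (map_sum f g x, map_sum f g y) \<in> chain_sum r2 r2'"
      if "x \<in> Field (chain_sum r1 r1')" "y \<in> Field (chain_sum r1 r1')" for x y
      using that unfolding Field_chain_sum by (auto simp: f(2) g(2))
  qed
qed

lemma chain_prod_cong:
  assumes "r1 \<cong>\<^sub>c r2" and unb: "\<And>b. b \<in> Field r' \<Longrightarrow> \<exists>b'. b' \<noteq> b \<and> (b, b') \<in> r'"
  shows "chain_prod r1 r' \<cong>\<^sub>c chain_prod r2 r'"
proof -
  obtain f where f: "bij_betw f (Field r1) (Field r2)"
    "\<And>x y. x \<in> Field r1 \<Longrightarrow> y \<in> Field r1 \<Longrightarrow> (x, y) \<in> r1 \<longleftrightarrow> (f x, f y) \<in> r2"
    using assms(1) by (rule chain_isoE) blast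
  have F: "Field (chain_prod r r') = Field r \<times> Field r'" for r :: "'x rel"
    using unb by (rule Field_chain_prod)
  show ?thesis
  proof (rule chain_isoI)
    show "bij_betw (map_prod f id) (Field (chain_prod r1 r')) (Field (chain_prod r2 r'))"
      unfolding F using f(1) by (intro bij_betw_map_prod) auto
    show "(x, y) \<in> chain_prod r1 r' \<longleftrightarrow> (map_prod f id x, map_prod f id y) \<in> chain_prod r2 r'"
      if "x \<in> Field (chain_prod r1 r')" "y \<in> Field (chain_prod r1 r')" for x y
      using that f bij_betwE[OF f(1)] unfolding F by (cases x; cases y) auto
  qed
qed

lemma chain_prod_int_cong: "r1 \<cong>\<^sub>c r2 \<Longrightarrow> chain_prod r1 int_chain \<cong>\<^sub>c chain_prod r2 int_chain"
  by (erule chain_prod_cong) (rule int_chain_unbounded)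

lemma chain_prod_nat_cong: "r1 \<cong>\<^sub>c r2 \<Longrightarrow> chain_prod r1 nat_chain \<cong>\<^sub>c chain_prod r2 nat_chain"
  by (erule chain_prod_cong) (rule nat_chain_unbounded)

lemma Linear_order_chain_sum:
  assumes "Linear_order r" and "Linear_order r'"
  shows "Linear_order (chain_sum r r')"
proof -
  have "trans (chain_sum r r')"
  proof (rule transI)
    fix x y z assume "(x, y) \<in> chain_sum r r'" "(y, z) \<in> chain_sum r r'"
    then show "(x, z) \<in> chain_sum r r'"
      using assms unfolding Linear_order_iff
      by (cases x; cases y; cases z) (auto dest: transD FieldI1 FieldI2)
  qed
  moreover have "antisym (chain_sum r r')"
  proof (rule antisymI)
    fix x y assume "(x, y) \<in> chain_sum r r'" "(y, x) \<in> chain_sum r r'"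
    then show "x = y"
      using assms unfolding Linear_order_iff
      by (cases x; cases y) (auto dest: antisymD)
  qed
  moreover have "(x, y) \<in> chain_sum r r' \<or> (y, x) \<in> chain_sum r r'"
    if "x \<in> Field (chain_sum r r')" "y \<in> Field (chain_sum r r')" for x y
    using that assms unfolding Linear_order_iff Field_chain_sum by (cases x; cases y) auto
  ultimately show ?thesis
    unfolding Linear_order_iff by blast
qed

lemma Linear_order_chain_prod:
  assumes r: "Linear_order r" and r': "Linear_order r'"
  shows "Linear_order (chain_prod r r')"
proof -
  have sub: "Field (chain_prod r r') \<subseteq> Field r \<times> Field r'"
    unfolding chain_prod_def by (auto simp: Field_def)
  have anti: "\<And>a b. (a, b) \<in> r' \<Longrightarrow> (b, a) \<in> r' \<Longrightarrow> a = b"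
    using r' unfolding Linear_order_iff antisym_def by blast
  have "trans (chain_prod r r')"
  proof (rule transI)
    fix x y z assume "(x, y) \<in> chain_prod r r'" "(y, z) \<in> chain_prod r r'"
    then show "(x, z) \<in> chain_prod r r'"
      using r r' anti unfolding Linear_order_iff
      by (cases x; cases y; cases z) (auto dest: transD)
  qed
  moreover have "antisym (chain_prod r r')"
  proof (rule antisymI)
    fix x y assume "(x, y) \<in> chain_prod r r'" "(y, x) \<in> chain_prod r r'"
    then show "x = y"
      using r anti unfolding Linear_order_iff
      by (cases x; cases y) (auto dest: antisymD)
  qed
  moreover have "(x, y) \<in> chain_prod r r' \<or> (y, x) \<in> chain_prod r r'"
    if "x \<in> Field r \<times> Field r'" "y \<in> Field r \<times> Field r'" for x y
    using that r r' unfolding Linear_order_iff by (cases x; cases y) auto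
  ultimately show ?thesis
    unfolding Linear_order_iff using sub by blast
qed


section \<open>Final segments and uniform chains\<close>

lemma final_seg_iff [simp]:
  "(y, z) \<in> final_seg r x \<longleftrightarrow> (y, z) \<in> r \<and> (x, y) \<in> r \<and> (x, z) \<in> r"
  by (auto simp: final_seg_def above_def)

lemma Field_final_seg:
  assumes "Linear_order r"
  shows "Field (final_seg r x) = {y. (x, y) \<in> r}"
proof -
  have "(y, y) \<in> final_seg r x" if "(x, y) \<in> r" for y
    using that assms by (auto simp: Linear_order_iff FieldI2)
  then show ?thesis
    by (fastforce simp: Field_def)
qed

lemma final_seg_chain_iso:
  assumes r: "Linear_order r" and r': "Linear_order r'"
    and f: "bij_betw f (Field r) (Field r')"
      "\<And>x y. x \<in> Field r \<Longrightarrow> y \<in> Field r \<Longrightarrow> (x, y) \<in> r \<longleftrightarrow> (f x, f y) \<in> r'"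
    and x: "x \<in> Field r"
  shows "final_seg r x \<cong>\<^sub>c final_seg r' (f x)"
proof (rule chain_isoI)
  have "f ` {y. (x, y) \<in> r} = {z. (f x, z) \<in> r'}"
  proof
    show "f ` {y. (x, y) \<in> r} \<subseteq> {z. (f x, z) \<in> r'}"
      using f(2)[OF x FieldI2] by auto
    show "{z. (f x, z) \<in> r'} \<subseteq> f ` {y. (x, y) \<in> r}"
    proof clarify
      fix z assume z: "(f x, z) \<in> r'"
      then obtain y where "y \<in> Field r" "z = f y"
        using f(1) by (metis FieldI2 bij_betw_imp_surj_on imageE)
      then show "z \<in> f ` {y. (x, y) \<in> r}"
        using z f(2)[OF x] by blast
    qed
  qed
  moreover have "inj_on f {y. (x, y) \<in> r}"
    using bij_betw_imp_inj_on[OF f(1)] by (rule inj_on_subset) (auto intro: FieldI2)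
  ultimately show "bij_betw f (Field (final_seg r x)) (Field (final_seg r' (f x)))"
    unfolding Field_final_seg[OF r] Field_final_seg[OF r'] bij_betw_def by blast
  show "(y, z) \<in> final_seg r x \<longleftrightarrow> (f y, f z) \<in> final_seg r' (f x)"
    if "y \<in> Field (final_seg r x)" "z \<in> Field (final_seg r x)" for y z
  proof -
    have "(x, y) \<in> r" "(x, z) \<in> r"
      using that unfolding Field_final_seg[OF r] by auto
    moreover from this have "y \<in> Field r" "z \<in> Field r"
      by (auto intro: FieldI2)
    ultimately show ?thesis
      using f(2) x by simp
  qed
qed

lemma final_seg_chain_sum_Inl:
  assumes r: "Linear_order r" and r': "Linear_order r'" and a: "a \<in> Field r"
  shows "final_seg (chain_sum r r') (Inl a) \<cong>\<^sub>c chain_sum (final_seg r a) r'"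
proof (rule chain_isoI)
  have F: "Field (final_seg (chain_sum r r') (Inl a)) = Field (chain_sum (final_seg r a) r')"
    unfolding Field_chain_sum Field_final_seg[OF r]
      Field_final_seg[OF Linear_order_chain_sum[OF r r']]
  proof (rule set_eqI)
    show "z \<in> {y. (Inl a, y) \<in> chain_sum r r'} \<longleftrightarrow> z \<in> Inl ` {y. (a, y) \<in> r} \<union> Inr ` Field r'" for z
      using a by (cases z) auto
  qed
  then show "bij_betw id (Field (final_seg (chain_sum r r') (Inl a)))
      (Field (chain_sum (final_seg r a) r'))"
    by simp
  show "(x, y) \<in> final_seg (chain_sum r r') (Inl a) \<longleftrightarrow>
      (id x, id y) \<in> chain_sum (final_seg r a) r'" for x y
    using a by (cases x; cases y) (auto simp: Field_final_seg[OF r] FieldI1 FieldI2)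
qed

lemma final_seg_chain_sum_Inr:
  assumes r: "Linear_order r" and r': "Linear_order r'"
  shows "final_seg (chain_sum r r') (Inr b) \<cong>\<^sub>c final_seg r' b"
proof (rule chain_iso_sym, rule chain_isoI)
  have "{y. (Inr b, y) \<in> chain_sum r r'} = Inr ` {y. (b, y) \<in> r'}"
  proof (rule set_eqI)
    show "z \<in> {y. (Inr b, y) \<in> chain_sum r r'} \<longleftrightarrow> z \<in> Inr ` {y. (b, y) \<in> r'}" for z
      by (cases z) auto
  qed
  then show "bij_betw Inr (Field (final_seg r' b)) (Field (final_seg (chain_sum r r') (Inr b)))"
    unfolding Field_final_seg[OF r'] Field_final_seg[OF Linear_order_chain_sum[OF r r']]
    by (simp add: bij_betw_def)
  show "(x, y) \<in> final_seg r' b \<longleftrightarrow> (Inr x, Inr y) \<in> final_seg (chain_sum r r') (Inr b)" for x y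
    by simp
qed

lemma final_seg_chain_prod_int:
  assumes r: "Linear_order r" and a: "a \<in> Field r"
  shows "final_seg (chain_prod r int_chain) (a, k) \<cong>\<^sub>c
    chain_sum (final_seg r a) (chain_prod r nat_chain)"
proof (rule chain_iso_sym, rule chain_isoI)
  \<comment> \<open>The copy of \<open>r\<close> with index \<open>k\<close> contributes the final segment; the copies with
    indices \<open>k + 1, k + 2, \<dots>\<close> are renumbered from \<open>0\<close>.\<close>
  let ?f = "case_sum (\<lambda>x. (x, k)) (\<lambda>(x, j). (x, k + 1 + int j))"
  have lin: "Linear_order (chain_prod r int_chain)"
    using r Linear_order_int_chain by (rule Linear_order_chain_prod)
  have F1: "Field (final_seg (chain_prod r int_chain) (a, k)) =
      {y. ((a, k), y) \<in> chain_prod r int_chain}"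
    by (rule Field_final_seg[OF lin])
  have F2: "Field (chain_sum (final_seg r a) (chain_prod r nat_chain)) =
      Inl ` {y. (a, y) \<in> r} \<union> Inr ` (Field r \<times> UNIV)"
    by (simp add: Field_chain_sum Field_final_seg[OF r])
  have "{y. ((a, k), y) \<in> chain_prod r int_chain} \<subseteq>
      ?f ` (Inl ` {y. (a, y) \<in> r} \<union> Inr ` (Field r \<times> UNIV))"
  proof clarify
    fix x i assume *: "((a, k), (x, i)) \<in> chain_prod r int_chain"
    show "(x, i) \<in> ?f ` (Inl ` {y. (a, y) \<in> r} \<union> Inr ` (Field r \<times> UNIV))"
    proof (cases "k = i")
      case True
      then show ?thesis using * by (intro image_eqI[of _ _ "Inl x"]) auto
    next
      case False
      then show ?thesis using *
        by (intro image_eqI[of _ _ "Inr (x, nat (i - k - 1))"]) auto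
    qed
  qed
  moreover have "?f ` (Inl ` {y. (a, y) \<in> r} \<union> Inr ` (Field r \<times> UNIV)) \<subseteq>
      {y. ((a, k), y) \<in> chain_prod r int_chain}"
    using a by (auto simp: FieldI2)
  moreover have "inj_on ?f (Inl ` {y. (a, y) \<in> r} \<union> Inr ` (Field r \<times> UNIV))"
    by (auto simp: inj_on_def)
  ultimately show "bij_betw ?f (Field (chain_sum (final_seg r a) (chain_prod r nat_chain)))
      (Field (final_seg (chain_prod r int_chain) (a, k)))"
    unfolding F1 F2 bij_betw_def by blast
  show "(x, y) \<in> chain_sum (final_seg r a) (chain_prod r nat_chain) \<longleftrightarrow>
      (?f x, ?f y) \<in> final_seg (chain_prod r int_chain) (a, k)"
    if "x \<in> Field (chain_sum (final_seg r a) (chain_prod r nat_chain))"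
      "y \<in> Field (chain_sum (final_seg r a) (chain_prod r nat_chain))" for x y
    using that a unfolding F2 by (auto simp: FieldI2 Field_final_seg[OF r])
qed

lemma final_seg_chain_prod_nat:
  assumes r: "Linear_order r" and a: "a \<in> Field r"
  shows "final_seg (chain_prod r nat_chain) (a, k) \<cong>\<^sub>c
    chain_sum (final_seg r a) (chain_prod r nat_chain)"
proof -
  \<comment> \<open>The embedding of \<open>r \<nat>\<close> into \<open>r \<int>\<close> identifies the final segments at \<open>(a, k)\<close>.\<close>
  have lin: "Linear_order (chain_prod r int_chain)" "Linear_order (chain_prod r nat_chain)"
    using r by (blast intro: Linear_order_chain_prod Linear_order_int_chain Linear_order_nat_chain)+
  let ?f = "map_prod id int"
  have "final_seg (chain_prod r nat_chain) (a, k) \<cong>\<^sub>c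
      final_seg (chain_prod r int_chain) (a, int k)"
  proof (rule chain_isoI)
    have "{y. ((a, int k), y) \<in> chain_prod r int_chain} \<subseteq>
        ?f ` {y. ((a, k), y) \<in> chain_prod r nat_chain}"
    proof clarify
      fix x i assume "((a, int k), (x, i)) \<in> chain_prod r int_chain"
      then show "(x, i) \<in> ?f ` {y. ((a, k), y) \<in> chain_prod r nat_chain}"
        by (intro image_eqI[of _ _ "(x, nat i)"]) auto
    qed
    moreover have "?f ` {y. ((a, k), y) \<in> chain_prod r nat_chain} \<subseteq>
        {y. ((a, int k), y) \<in> chain_prod r int_chain}"
      by auto
    moreover have "inj ?f"
      by (simp add: prod.inj_map)
    ultimately show "bij_betw ?f (Field (final_seg (chain_prod r nat_chain) (a, k)))
        (Field (final_seg (chain_prod r int_chain) (a, int k)))"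
      unfolding Field_final_seg[OF lin(1)] Field_final_seg[OF lin(2)] bij_betw_def
      by (blast intro: inj_on_subset)
    show "(x, y) \<in> final_seg (chain_prod r nat_chain) (a, k) \<longleftrightarrow>
        (?f x, ?f y) \<in> final_seg (chain_prod r int_chain) (a, int k)" for x y
      by (cases x; cases y) auto
  qed
  also have "\<dots> \<cong>\<^sub>c chain_sum (final_seg r a) (chain_prod r nat_chain)"
    using assms by (rule final_seg_chain_prod_int)
  finally show ?thesis .
qed

lemma uniform_chain_imp_Linear_order: "uniform_chain r \<Longrightarrow> Linear_order r"
  by (simp add: uniform_chain_def)

lemma final_seg_iso_tail:
  assumes "uniform_chain r" and "x \<in> Field r"
  shows "final_seg r x \<cong>\<^sub>c tail r"
proof -
  have "(SOME x. x \<in> Field r) \<in> Field r"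
    using assms(2) by (rule someI)
  then show ?thesis
    using assms unfolding uniform_chain_def tail_def by blast
qed

text \<open>Uniformity together with the type of the tail; non-emptiness is included because
  \<^const>\<open>tail\<close> is meaningful for nonempty chains only.\<close>

definition uniform_with_tail :: "'a rel \<Rightarrow> 'b rel \<Rightarrow> bool" where
  "uniform_with_tail r T \<longleftrightarrow> uniform_chain r \<and> Field r \<noteq> {} \<and> tail r \<cong>\<^sub>c T"

lemma uniform_with_tail_iff:
  "uniform_with_tail r T \<longleftrightarrow>
     Linear_order r \<and> Field r \<noteq> {} \<and> (\<forall>x\<in>Field r. final_seg r x \<cong>\<^sub>c T)"
proof
  assume "uniform_with_tail r T"
  then show "Linear_order r \<and> Field r \<noteq> {} \<and> (\<forall>x\<in>Field r. final_seg r x \<cong>\<^sub>c T)"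
    unfolding uniform_with_tail_def
    by (blast intro: final_seg_iso_tail chain_iso_trans uniform_chain_imp_Linear_order)
next
  assume R: "Linear_order r \<and> Field r \<noteq> {} \<and> (\<forall>x\<in>Field r. final_seg r x \<cong>\<^sub>c T)"
  then have "uniform_chain r"
    unfolding uniform_chain_def by (blast intro: chain_iso_trans chain_iso_sym)
  moreover have "tail r \<cong>\<^sub>c T"
    using R unfolding tail_def by (simp add: some_in_eq)
  ultimately show "uniform_with_tail r T"
    using R unfolding uniform_with_tail_def by blast
qed

lemma uniform_with_tail_chain_iso:
  assumes "uniform_with_tail r T" and iso: "r \<cong>\<^sub>c r'" and "T \<cong>\<^sub>c T'"
  shows "uniform_with_tail r' T'"
proof -
  have r: "Linear_order r" "Field r \<noteq> {}" "\<And>x. x \<in> Field r \<Longrightarrow> final_seg r x \<cong>\<^sub>c T"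
    using assms(1) unfolding uniform_with_tail_iff by blast+
  have r': "Linear_order r'"
    using r(1) iso by (rule Linear_order_chain_iso)
  obtain f where f: "bij_betw f (Field r') (Field r)"
    "\<And>x y. x \<in> Field r' \<Longrightarrow> y \<in> Field r' \<Longrightarrow> (x, y) \<in> r' \<longleftrightarrow> (f x, f y) \<in> r"
    using chain_iso_sym[OF iso] by (rule chain_isoE) blast
  have "final_seg r' x \<cong>\<^sub>c T'" if "x \<in> Field r'" for x
  proof -
    have "final_seg r' x \<cong>\<^sub>c final_seg r (f x)"
      using r' r(1) f that by (rule final_seg_chain_iso)
    also have "\<dots> \<cong>\<^sub>c T"
      using r(3) that bij_betwE[OF f(1)] by blast
    finally show ?thesis
      using assms(3) by (rule chain_iso_trans)
  qed
  then show ?thesis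
    using r' r(2) chain_iso_Field_empty_iff[OF iso] unfolding uniform_with_tail_iff by blast
qed

lemma uniform_with_tail_prod_int:
  assumes "uniform_with_tail r T"
  shows "uniform_with_tail (chain_prod r int_chain) (chain_sum T (chain_prod r nat_chain))"
proof -
  have r: "Linear_order r" "Field r \<noteq> {}" "\<And>x. x \<in> Field r \<Longrightarrow> final_seg r x \<cong>\<^sub>c T"
    using assms unfolding uniform_with_tail_iff by blast+
  have "final_seg (chain_prod r int_chain) p \<cong>\<^sub>c chain_sum T (chain_prod r nat_chain)"
    if p: "p \<in> Field (chain_prod r int_chain)" for p
  proof -
    obtain a k where a: "p = (a, k)" "a \<in> Field r"
      using p by auto
    then show ?thesis
      using final_seg_chain_prod_int[OF r(1) a(2), of k] r(3)[OF a(2)]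
      by (metis chain_iso_trans chain_sum_cong chain_iso_refl)
  qed
  then show ?thesis
    using r Linear_order_chain_prod[OF r(1) Linear_order_int_chain]
    unfolding uniform_with_tail_iff by auto
qed

text \<open>A point of \<open>r'\<nat>\<close> cuts off a tail of \<open>r'\<close> followed by a copy of \<open>r'\<nat>\<close>, so a common tail of
  \<open>r\<close> and \<open>r'\<close> is what makes \<open>r + r'\<nat>\<close> uniform.\<close>

lemma uniform_with_tail_sum_prod_nat:
  assumes "uniform_with_tail r T" and "uniform_with_tail r' T"
  shows "uniform_with_tail (chain_sum r (chain_prod r' nat_chain))
    (chain_sum T (chain_prod r' nat_chain))"
proof -
  have r: "Linear_order r" "Field r \<noteq> {}" "\<And>x. x \<in> Field r \<Longrightarrow> final_seg r x \<cong>\<^sub>c T"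
    using assms(1) unfolding uniform_with_tail_iff by blast+
  have r': "Linear_order r'" "\<And>x. x \<in> Field r' \<Longrightarrow> final_seg r' x \<cong>\<^sub>c T"
    using assms(2) unfolding uniform_with_tail_iff by blast+
  let ?N = "chain_prod r' nat_chain"
  have N: "Linear_order ?N"
    using r'(1) Linear_order_nat_chain by (rule Linear_order_chain_prod)
  have "final_seg (chain_sum r ?N) p \<cong>\<^sub>c chain_sum T ?N" if p: "p \<in> Field (chain_sum r ?N)" for p
  proof (cases p)
    case (Inl a)
    then have "a \<in> Field r"
      using p by (auto simp: Field_chain_sum)
    then show ?thesis
      using final_seg_chain_sum_Inl[OF r(1) N] r(3) Inl
      by (metis chain_iso_trans chain_sum_cong chain_iso_refl)
  next
    case (Inr q)
    then obtain a k where a: "q = (a, k)" "a \<in> Field r'"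
      using p by (auto simp: Field_chain_sum)
    have "final_seg (chain_sum r ?N) p \<cong>\<^sub>c final_seg ?N (a, k)"
      unfolding Inr a(1) using r(1) N by (rule final_seg_chain_sum_Inr)
    also have "\<dots> \<cong>\<^sub>c chain_sum (final_seg r' a) ?N"
      using r'(1) a(2) by (rule final_seg_chain_prod_nat)
    also have "\<dots> \<cong>\<^sub>c chain_sum T ?N"
      using r'(2)[OF a(2)] chain_iso_refl by (rule chain_sum_cong)
    finally show ?thesis .
  qed
  then show ?thesis
    using r Linear_order_chain_sum[OF r(1) N]
    unfolding uniform_with_tail_iff by (auto simp: Field_chain_sum)
qed

lemma has_rank_imp_Field_nonempty:
  assumes "has_rank r \<alpha>"
  shows "Field r \<noteq> {}"
proof
  assume "Field r = {}"
  then have "r = {}"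
    by (auto simp: Field_def)
  then have "Field (quot_chain r (rho r \<alpha>)) = {}"
    by (simp add: quot_chain_def)
  moreover have "quot_chain r (rho r \<alpha>) \<cong>\<^sub>c one_chain"
    using assms by (simp add: has_rank_def)
  ultimately show False
    by (auto dest: chain_iso_Field_empty_iff simp: one_chain_def)
qed


section \<open>Leaf weights and the recursion on sequences\<close>

text \<open>The second components of the leaves below the node \<open>(s; k)\<close>, from left to right. The root
  label \<open>k\<close> is kept arbitrary since the left subtree of a node carries a nonzero label.\<close>

definition leaf_weights :: "nat list \<Rightarrow> nat \<Rightarrow> nat list" where
  "leaf_weights s k = map snd (leaves (node_tree s k))"

lemma seq_minus_snoc [simp]: "seq_minus (t @ [c, a]) = t @ [c]"
  by (simp add: seq_minus_def butlast_append)

lemma seq_plus_snoc [simp]: "seq_plus (t @ [c, a]) = t @ [a]"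
  by (simp add: seq_plus_def butlast_append)

lemma seq_f_snoc [simp]: "seq_f (t @ [a]) = t @ [0]"
  by (simp add: seq_f_def)

lemma leaf_weights_single [simp]: "leaf_weights [a] k = [k]"
  by (simp add: leaf_weights_def node_tree.simps)

lemma leaf_weights_snoc:
  "leaf_weights (t @ [c, a]) k =
     (if a = Suc (length t) then leaf_weights (t @ [c]) 0
      else leaf_weights (t @ [a]) (k + 1) @ leaf_weights (t @ [c]) 0)"
  unfolding leaf_weights_def by (subst node_tree.simps) simp

lemma seq_chain_single: "seq_chain [a] M = dir_image (M ! 0) Base_pt"
  by (subst seq_chain.simps) simp

lemma seq_chain_snoc_max:
  "a = Suc (length t) \<Longrightarrow>
   seq_chain (t @ [c, a]) M = dir_image (chain_prod (seq_chain (t @ [c]) M) int_chain) Prod_pt"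
  by (subst seq_chain.simps) simp

lemma seq_chain_snoc_less:
  "a \<noteq> Suc (length t) \<Longrightarrow> length M = ell (t @ [a]) \<Longrightarrow>
   seq_chain (t @ [c, a]) (M @ M') =
     dir_image (chain_sum (seq_chain (t @ [a]) M)
       (chain_prod (seq_chain (t @ [c]) M') nat_chain)) Sum_pt"
  by (subst seq_chain.simps) simp

lemma tail_array_single: "tail_array [a] M = [tail (M ! 0)]"
  by (subst tail_array.simps) simp

lemma tail_array_snoc_max:
  "a = Suc (length t) \<Longrightarrow> tail_array (t @ [c, a]) M = tail_array (t @ [c]) M @ M"
  by (subst tail_array.simps) simp

lemma tail_array_snoc_less:
  "a \<noteq> Suc (length t) \<Longrightarrow> length M = ell (t @ [a]) \<Longrightarrow>
   tail_array (t @ [c, a]) (M @ M') = tail_array (t @ [a]) M @ M'"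
  by (subst tail_array.simps) simp

text \<open>Induction along the recursion that \<open>s \<mapsto> s\<^sup>-\<close> and \<open>s \<mapsto> s\<^sup>+\<close> provide.\<close>

lemma seq_induct [consumes 1, case_names single snoc]:
  assumes "s \<noteq> []"
    and single: "\<And>a. P [a]"
    and snoc: "\<And>t c a. P (t @ [c]) \<Longrightarrow> P (t @ [a]) \<Longrightarrow> P (t @ [c, a])"
  shows "P s"
  using assms(1)
proof (induction s rule: length_induct)
  case (1 s)
  then obtain u a where s: "s = u @ [a]"
    by (meson rev_exhaust)
  show ?case
  proof (cases u rule: rev_cases)
    case Nil
    then show ?thesis using s single by simp
  next
    case (snoc t c)
    then have "P (t @ [c])" "P (t @ [a])"
      using 1(1) s by simp_all
    then show ?thesis
      using s snoc assms(3) by simp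
  qed
qed

lemma length_leaf_weights: "s \<noteq> [] \<Longrightarrow> length (leaf_weights s k) = ell s"
proof -
  have "length (leaf_weights s k) = length (leaf_weights s k')" if "s \<noteq> []" for k k'
    using that by (induction s arbitrary: k k' rule: seq_induct) (auto simp: leaf_weights_snoc)
  then show "s \<noteq> [] \<Longrightarrow> length (leaf_weights s k) = ell s"
    by (metis ell_def leaf_weights_def length_map tree_def)
qed

lemma ell_single [simp]: "ell [a] = 1"
  by (simp flip: length_leaf_weights[where k = 0])

lemma ell_snoc:
  "ell (t @ [c, a]) = (if a = Suc (length t) then ell (t @ [c]) else ell (t @ [a]) + ell (t @ [c]))"
  using length_leaf_weights[of "t @ [c, a]" 0]
  by (cases "a = Suc (length t)") (simp_all add: leaf_weights_snoc length_leaf_weights)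

text \<open>One unfolding of the tail array, uniform in the two cases of the recursion. For
  \<open>a = length t + 1\<close> the pieces are \<open>M1 = M2 = M\<close>, both with the weights of the node
  \<open>(t @ [c]; 0)\<close>, so \<open>a' = c\<close>; otherwise \<open>M\<close> is cut at \<open>ell (t @ [a])\<close> and \<open>a' = a\<close>.\<close>

lemma tail_array_split:
  assumes "length M = ell (t @ [c, a])"
  obtains a' k' M1 M2 where
    "length M1 = ell (t @ [a'])" "length M2 = ell (t @ [c])"
    "tail_array (t @ [c, a]) M = tail_array (t @ [a']) M1 @ M2"
    "set (zip (leaf_weights (t @ [a']) k') M1) \<subseteq> set (zip (leaf_weights (t @ [c, a]) k) M)"
    "set (zip (leaf_weights (t @ [c]) 0) M2) \<subseteq> set (zip (leaf_weights (t @ [c, a]) k) M)"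
    "set M1 \<subseteq> set M"
proof (cases "a = Suc (length t)")
  case True
  show ?thesis
    by (rule that[of M c M 0])
      (use assms True in \<open>auto simp: ell_snoc leaf_weights_snoc tail_array_snoc_max\<close>)
next
  case False
  define M1 M2 where "M1 = take (ell (t @ [a])) M" and "M2 = drop (ell (t @ [a])) M"
  have M: "M = M1 @ M2" "length M1 = ell (t @ [a])" "length M2 = ell (t @ [c])"
    using assms False by (auto simp: M1_def M2_def ell_snoc)
  show ?thesis
    by (rule that[of M1 a M2 "k + 1"])
      (use M False in \<open>auto simp: leaf_weights_snoc tail_array_snoc_less length_leaf_weights\<close>)
qed

lemma length_tail_array:
  "length M = ell (t @ [a]) \<Longrightarrow> length (tail_array (t @ [a]) M) = ell (t @ [0])"
proof (induction t arbitrary: a M rule: rev_induct)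
  case Nil
  then show ?case by (simp add: tail_array_single)
next
  case (snoc c t)
  then obtain a' k' M1 M2 where "length M1 = ell (t @ [a'])" "length M2 = ell (t @ [c])"
    "tail_array (t @ [c, a]) M = tail_array (t @ [a']) M1 @ M2"
    by (auto elim: tail_array_split[where k = 0])
  then show ?case
    using snoc.IH by (simp add: ell_snoc)
qed

lemma seq_chain_cong:
  assumes "s \<noteq> []" and "length M = ell s" and "list_all2 (\<cong>\<^sub>c) M M'"
  shows "seq_chain s M \<cong>\<^sub>c seq_chain s M'"
  using assms
proof (induction s arbitrary: M M' rule: seq_induct)
  case (single a)
  have "M ! 0 \<cong>\<^sub>c M' ! 0"
    using single list_all2_nthD[of _ M M' 0] by simp
  moreover have "inj (Base_pt :: 'a \<Rightarrow> 'a point)" "inj (Base_pt :: 'b \<Rightarrow> 'b point)"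
    by (auto intro: injI)
  ultimately show ?case
    unfolding seq_chain_single
    by (meson chain_iso_dir_image chain_iso_sym chain_iso_trans)
next
  case (snoc t c a)
  show ?case
  proof (cases "a = Suc (length t)")
    case True
    have "seq_chain (t @ [c]) M \<cong>\<^sub>c seq_chain (t @ [c]) M'"
      using snoc True by (simp add: ell_snoc)
    then have "chain_prod (seq_chain (t @ [c]) M) int_chain \<cong>\<^sub>c
        chain_prod (seq_chain (t @ [c]) M') int_chain"
      by (rule chain_prod_int_cong)
    moreover have "inj (Prod_pt :: 'a point \<times> int \<Rightarrow> 'a point)"
        "inj (Prod_pt :: 'b point \<times> int \<Rightarrow> 'b point)"
      by (auto intro: injI)
    ultimately show ?thesis
      unfolding seq_chain_snoc_max[OF True]
      by (meson chain_iso_dir_image chain_iso_sym chain_iso_trans)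
  next
    case False
    let ?m = "ell (t @ [a])"
    have len: "length (take ?m M) = ?m" "length (take ?m M') = ?m"
        "length (drop ?m M) = ell (t @ [c])"
      using snoc.prems False list_all2_lengthD[OF snoc.prems(2)] by (auto simp: ell_snoc)
    have "seq_chain (t @ [a]) (take ?m M) \<cong>\<^sub>c seq_chain (t @ [a]) (take ?m M')"
      using snoc.IH(2) len(1) list_all2_takeI[OF snoc.prems(2)] by blast
    moreover have "seq_chain (t @ [c]) (drop ?m M) \<cong>\<^sub>c seq_chain (t @ [c]) (drop ?m M')"
      using snoc.IH(1) len(3) list_all2_dropI[OF snoc.prems(2)] by blast
    ultimately have "chain_sum (seq_chain (t @ [a]) (take ?m M))
          (chain_prod (seq_chain (t @ [c]) (drop ?m M)) nat_chain) \<cong>\<^sub>c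
        chain_sum (seq_chain (t @ [a]) (take ?m M'))
          (chain_prod (seq_chain (t @ [c]) (drop ?m M')) nat_chain)"
      by (intro chain_sum_cong chain_prod_nat_cong)
    moreover have "inj (Sum_pt :: 'a point + 'a point \<times> nat \<Rightarrow> 'a point)"
        "inj (Sum_pt :: 'b point + 'b point \<times> nat \<Rightarrow> 'b point)"
      by (auto intro: injI)
    ultimately have "seq_chain (t @ [c, a]) (take ?m M @ drop ?m M) \<cong>\<^sub>c
        seq_chain (t @ [c, a]) (take ?m M' @ drop ?m M')"
      unfolding seq_chain_snoc_less[OF False len(1)] seq_chain_snoc_less[OF False len(2)]
      by (meson chain_iso_dir_image chain_iso_sym chain_iso_trans)
    then show ?thesis by simp
  qed
qed

text \<open>Up to isomorphism, the tail array does not depend on the last entry of the sequence, provided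
  that leaves of equal weight in the two trees carry isomorphic chains and that the tails agree. For
  either sequence, the last \<open>ell (t @ [c])\<close> entries are chains with the weights of the node
  \<open>(t @ [c]; 0)\<close>; the other entries form a tail array for a sequence that is \<open>t\<close> with one more
  entry, and so are covered by induction.\<close>

lemma tail_array_last_entry:
  assumes "length M = ell (t @ [a])" and "length M' = ell (t @ [b])"
    and "\<And>r r'. r \<in> set M \<Longrightarrow> r' \<in> set M' \<Longrightarrow> tail r \<cong>\<^sub>c tail r'"
    and "\<And>w r r'. (w, r) \<in> set (zip (leaf_weights (t @ [a]) k) M) \<Longrightarrow>
      (w, r') \<in> set (zip (leaf_weights (t @ [b]) k') M') \<Longrightarrow> r \<cong>\<^sub>c r'"
  shows "list_all2 (\<cong>\<^sub>c) (tail_array (t @ [a]) M) (tail_array (t @ [b]) M')"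
  using assms
proof (induction t arbitrary: a b k k' M M' rule: rev_induct)
  case Nil
  then show ?case by (simp add: tail_array_single)
next
  case (snoc c t)
  have "length M = ell (t @ [c, a])"
    using snoc.prems by simp
  then obtain a1 k1 M1 M2 where 1: "length M1 = ell (t @ [a1])" "length M2 = ell (t @ [c])"
    "tail_array (t @ [c, a]) M = tail_array (t @ [a1]) M1 @ M2"
    "set (zip (leaf_weights (t @ [a1]) k1) M1) \<subseteq> set (zip (leaf_weights (t @ [c, a]) k) M)"
    "set (zip (leaf_weights (t @ [c]) 0) M2) \<subseteq> set (zip (leaf_weights (t @ [c, a]) k) M)"
    "set M1 \<subseteq> set M"
    by (rule tail_array_split)
  have "length M' = ell (t @ [c, b])"
    using snoc.prems by simp
  then obtain b1 k1' M1' M2' where 2: "length M1' = ell (t @ [b1])" "length M2' = ell (t @ [c])"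
    "tail_array (t @ [c, b]) M' = tail_array (t @ [b1]) M1' @ M2'"
    "set (zip (leaf_weights (t @ [b1]) k1') M1') \<subseteq> set (zip (leaf_weights (t @ [c, b]) k') M')"
    "set (zip (leaf_weights (t @ [c]) 0) M2') \<subseteq> set (zip (leaf_weights (t @ [c, b]) k') M')"
    "set M1' \<subseteq> set M'"
    by (rule tail_array_split)
  have compat: "r \<cong>\<^sub>c r'" if "(w, r) \<in> set (zip (leaf_weights (t @ [c, a]) k) M)"
    "(w, r') \<in> set (zip (leaf_weights (t @ [c, b]) k') M')" for w r r'
    using snoc.prems(4)[of w r r'] that by simp
  have "list_all2 (\<cong>\<^sub>c) (tail_array (t @ [a1]) M1) (tail_array (t @ [b1]) M1')"
    by (rule snoc.IH[OF 1(1) 2(1)]) (use 1(4,6) 2(4,6) snoc.prems(3) compat in blast)+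
  moreover have "list_all2 (\<cong>\<^sub>c) M2 M2'"
  proof (rule list_all2_all_nthI)
    fix i assume i: "i < length M2"
    let ?w = "leaf_weights (t @ [c]) 0"
    have len: "length ?w = ell (t @ [c])"
      by (simp add: length_leaf_weights)
    have "(?w ! i, M2 ! i) \<in> set (zip ?w M2)" "(?w ! i, M2' ! i) \<in> set (zip ?w M2')"
      using i len 1(2) 2(2) unfolding set_zip by auto
    then show "M2 ! i \<cong>\<^sub>c M2' ! i"
      using 1(5) 2(5) compat by blast
  qed (use 1(2) 2(2) in simp)
  ultimately show ?case
    using 1(3) 2(3) by (simp add: list_all2_appendI)
qed


section \<open>Uniformity and tail of the chain of a sequence\<close>

lemma uniform_with_tail_seq_chain:
  assumes "s \<noteq> []" and "length M = ell s"
    and "\<And>r. r \<in> set M \<Longrightarrow> uniform_chain r \<and> Field r \<noteq> {}"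
    and "\<And>r r'. r \<in> set M \<Longrightarrow> r' \<in> set M \<Longrightarrow> tail r \<cong>\<^sub>c tail r'"
    and "\<And>w r r'. (w, r) \<in> set (zip (leaf_weights s k) M) \<Longrightarrow>
      (w, r') \<in> set (zip (leaf_weights s k) M) \<Longrightarrow> r \<cong>\<^sub>c r'"
  shows "uniform_with_tail (seq_chain s M) (seq_chain (seq_f s) (tail_array s M))"
  using assms
proof (induction s arbitrary: k M rule: seq_induct)
  case (single a)
  have "M ! 0 \<in> set M"
    using single.prems(1) by simp
  then have "uniform_with_tail (M ! 0) (tail (M ! 0))"
    using single.prems(2) unfolding uniform_with_tail_def by (blast intro: chain_iso_refl)
  moreover have "inj (Base_pt :: 'a \<Rightarrow> 'a point)"
    by (auto intro: injI)
  ultimately show ?case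
    using seq_f_snoc[of "[]" a]
    by (auto simp: seq_chain_single tail_array_single
        intro!: chain_iso_dir_image elim!: uniform_with_tail_chain_iso)
next
  case (snoc t c a)
  have f: "seq_f (t @ [c, a]) = t @ [c, 0]"
    using seq_f_snoc[of "t @ [c]" a] by simp
  have inj: "inj (Prod_pt :: 'a point \<times> int \<Rightarrow> 'a point)"
      "inj (Sum_pt :: 'a point + 'a point \<times> nat \<Rightarrow> 'a point)"
    by (auto intro: injI)
  show ?case
  proof (cases "a = Suc (length t)")
    case True
    let ?B = "seq_chain (t @ [c]) M" and ?T = "seq_chain (t @ [0]) (tail_array (t @ [c]) M)"
    have len: "length M = ell (t @ [c])"
      using snoc.prems(1) True by (simp add: ell_snoc)
    have "uniform_with_tail ?B (seq_chain (seq_f (t @ [c])) (tail_array (t @ [c]) M))"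
      by (rule snoc.IH(1)[where k = 0])
        (use snoc.prems len True in \<open>auto simp: leaf_weights_snoc\<close>)
    then have "uniform_with_tail (chain_prod ?B int_chain)
        (chain_sum ?T (chain_prod ?B nat_chain))"
      unfolding seq_f_snoc by (rule uniform_with_tail_prod_int)
    moreover have "length (tail_array (t @ [c]) M) = ell (t @ [0])"
      using len by (rule length_tail_array)
    ultimately show ?thesis
      using inj unfolding f seq_chain_snoc_max[OF True] tail_array_snoc_max[OF True]
      by (auto simp: seq_chain_snoc_less
          intro!: chain_iso_dir_image elim!: uniform_with_tail_chain_iso)
  next
    case False
    define M1 M2 where "M1 = take (ell (t @ [a])) M" and "M2 = drop (ell (t @ [a])) M"
    have M: "M = M1 @ M2" "length M1 = ell (t @ [a])" "length M2 = ell (t @ [c])"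
      using snoc.prems(1) False by (auto simp: M1_def M2_def ell_snoc)
    have lw: "zip (leaf_weights (t @ [c, a]) k) M =
        zip (leaf_weights (t @ [a]) (k + 1)) M1 @ zip (leaf_weights (t @ [c]) 0) M2"
      using False M by (simp add: leaf_weights_snoc length_leaf_weights)
    have sub: "set M1 \<subseteq> set M" "set M2 \<subseteq> set M"
      by (auto simp: M(1))
    have compat: "r \<cong>\<^sub>c r'"
      if "(w, r) \<in> set (zip (leaf_weights (t @ [a]) (k + 1)) M1) \<union>
            set (zip (leaf_weights (t @ [c]) 0) M2)"
        "(w, r') \<in> set (zip (leaf_weights (t @ [a]) (k + 1)) M1) \<union>
            set (zip (leaf_weights (t @ [c]) 0) M2)" for w r r'
      using snoc.prems(4)[of w r r'] that unfolding lw by simp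
    let ?A = "seq_chain (t @ [a]) M1" and ?B = "seq_chain (t @ [c]) M2"
    let ?T = "seq_chain (t @ [0]) (tail_array (t @ [a]) M1)"
      and ?T' = "seq_chain (t @ [0]) (tail_array (t @ [c]) M2)"
    have A: "uniform_with_tail ?A (seq_chain (seq_f (t @ [a])) (tail_array (t @ [a]) M1))"
      by (rule snoc.IH(2)[OF M(2), where k = "k + 1"]) (use snoc.prems(2,3) sub compat in blast)+
    have B: "uniform_with_tail ?B (seq_chain (seq_f (t @ [c])) (tail_array (t @ [c]) M2))"
      by (rule snoc.IH(1)[OF M(3), where k = 0]) (use snoc.prems(2,3) sub compat in blast)+
    \<comment> \<open>Both tails are chains of the sequence \<open>t @ [0]\<close>; only the arrays have to be compared.\<close>
    have "list_all2 (\<cong>\<^sub>c) (tail_array (t @ [c]) M2) (tail_array (t @ [a]) M1)"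
      by (rule tail_array_last_entry[OF M(3,2), where k = 0 and k' = "k + 1"])
        (use snoc.prems(3) sub compat in blast)+
    then have "?T' \<cong>\<^sub>c ?T"
      by (rule seq_chain_cong[rotated 2]) (simp_all add: length_tail_array M(3))
    then have "uniform_with_tail ?B ?T"
      using B chain_iso_refl uniform_with_tail_chain_iso unfolding seq_f_snoc by blast
    with A have "uniform_with_tail (chain_sum ?A (chain_prod ?B nat_chain))
        (chain_sum ?T (chain_prod ?B nat_chain))"
      unfolding seq_f_snoc by (rule uniform_with_tail_sum_prod_nat)
    moreover have "length (tail_array (t @ [a]) M1) = ell (t @ [0])"
      using M(2) by (rule length_tail_array)
    ultimately show ?thesis
      using inj unfolding f M(1) seq_chain_snoc_less[OF False M(2)]
        tail_array_snoc_less[OF False M(2)]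
      by (auto simp: seq_chain_snoc_less
          intro!: chain_iso_dir_image elim!: uniform_with_tail_chain_iso)
  qed
qed

theorem mainTheorem3:
  fixes n :: nat and s :: "nat list" and M :: "'a rel list"
  assumes "s \<in> seqs (n + 1)"
    and "length M = ell s"
    and "\<And>i. i < ell s \<Longrightarrow> uniform_chain (M ! i) \<and> has_rank_omega (M ! i)"
    and "\<And>i j. i < ell s \<Longrightarrow> j < ell s \<Longrightarrow> tail (M ! i) \<cong>\<^sub>c tail (M ! j)"
    and "\<And>i j. i < ell s \<Longrightarrow> j < ell s \<Longrightarrow> wt s i = wt s j \<Longrightarrow> M ! i \<cong>\<^sub>c M ! j"
  shows "uniform_chain (seq_chain s M) \<and>
         tail (seq_chain s M) \<cong>\<^sub>c seq_chain (seq_f s) (tail_array s M)"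
proof -
  have s: "s \<noteq> []"
    using assms(1) by (auto simp: seqs_def)
  have len: "length (leaf_weights s 0) = ell s"
    using s by (rule length_leaf_weights)
  have wt: "leaf_weights s 0 ! i = wt s i" if "i < ell s" for i
    using that by (simp add: leaf_weights_def wt_def tree_def ell_def)
  have "uniform_with_tail (seq_chain s M) (seq_chain (seq_f s) (tail_array s M))"
  proof (rule uniform_with_tail_seq_chain[OF s assms(2), where k = 0])
    show "uniform_chain r \<and> Field r \<noteq> {}" if "r \<in> set M" for r
      using that assms(2,3) has_rank_imp_Field_nonempty
      unfolding has_rank_omega_def by (metis in_set_conv_nth)
    show "tail r \<cong>\<^sub>c tail r'" if "r \<in> set M" "r' \<in> set M" for r r'
      using that assms(2,4) by (metis in_set_conv_nth)
    show "r \<cong>\<^sub>c r'" if "(w, r) \<in> set (zip (leaf_weights s 0) M)"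
      "(w, r') \<in> set (zip (leaf_weights s 0) M)" for w r r'
      using that assms(2,5) len wt unfolding set_zip by auto
  qed
  then show ?thesis
    unfolding uniform_with_tail_def by blast
qed

end
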